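(* Let $U\subset\mathbb{R}^2$ be an open connected set, let $f=(f_1,f_2):U\to\mathbb{R}^2$ be a $C^2$ map such that $\det Df(z)\neq 0$ for every $z\in U$, and let $z_0\in U$ be such that $f(z_0)=(0,0)$. Let $H_f=\frac{f_1^2+f_2^2}{2}:U\to\mathbb{R}$, let $\nabla H_f^{\perp}=(-(H_f)_y,(H_f)_x)$ be the associated Hamiltonian vector field on $U$ (for which $z_0$ is a center), and let $\mathcal{P}_{z_0}$ be the period annulus of the center $z_0$ of $\nabla H_f^\perp$. Then $\mathcal{P}_{z_0}$ is the greatest (with respect to inclusion) open connected set $V\subset U$ containing $z_0$ such that (i) $f$ is injective in $V$ and (ii) $f(V)$ is $\mathbb{R}^2$ or an open disc centered at $(0,0)$. That is, $\mathcal{P}_{z_0}$ has these properties, and every open connected set $V\subset U$ containing $z_0$ and satisfying (i) and (ii) is contained in $\mathcal{P}_{z_0}$.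
   Context: Let $\mathcal{X}$ be a $C^1$ vector field on an open connected set $U\subset\mathbb{R}^2$. An isolated singular point (zero) $z_0$ of $\mathcal{X}$ is a center if there is a neighborhood $V\subset U$ of $z_0$ such that every orbit of $\mathcal{X}$ in $V\setminus\{z_0\}$ is periodic (non-constant). The period annulus $\mathcal{P}_{z_0}$ of a center $z_0$ is the maximal open connected set $W\subset U$ containing $z_0$ such that $W\setminus\{z_0\}$ is filled with (i.e. is a union of) periodic orbits of $\mathcal{X}$. *)

theory Defs
  imports "HOL-Analysis.Analysis"
begin

text \<open>Maps defined on an open set \<open>U\<close> are total functions whose values outside \<open>U\<close> are irrelevant.
  The two predicates below are meant for open \<open>U\<close>; continuity of the derivative refers to the
  operator norm.\<close>

definition C1_on :: "'a::real_normed_vector set \<Rightarrow> ('a \<Rightarrow> 'b::real_normed_vector) \<Rightarrow> bool" where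
  "C1_on U f \<longleftrightarrow>
     (\<exists>f' :: 'a \<Rightarrow> 'a \<Rightarrow>\<^sub>L 'b.
        (\<forall>x\<in>U. (f has_derivative blinfun_apply (f' x)) (at x)) \<and> continuous_on U f')"

definition C2_on :: "'a::real_normed_vector set \<Rightarrow> ('a \<Rightarrow> 'b::real_normed_vector) \<Rightarrow> bool" where
  "C2_on U f \<longleftrightarrow>
     (\<exists>f' :: 'a \<Rightarrow> 'a \<Rightarrow>\<^sub>L 'b.
        (\<forall>x\<in>U. (f has_derivative blinfun_apply (f' x)) (at x)) \<and> C1_on U f')"

definition jacobian_det :: "(real^2 \<Rightarrow> real^2) \<Rightarrow> real^2 \<Rightarrow> real" where
  "jacobian_det f z = det (matrix (frechet_derivative f (at z)))"

definition partial_deriv :: "2 \<Rightarrow> (real^2 \<Rightarrow> real) \<Rightarrow> real^2 \<Rightarrow> real" where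
  "partial_deriv i H z = frechet_derivative H (at z) (axis i 1)"

definition hamiltonian_field :: "(real^2 \<Rightarrow> real) \<Rightarrow> real^2 \<Rightarrow> real^2" where
  "hamiltonian_field H z = vector [- partial_deriv 2 H z, partial_deriv 1 H z]"

definition half_sq_norm :: "(real^2 \<Rightarrow> real^2) \<Rightarrow> real^2 \<Rightarrow> real" where
  "half_sq_norm f z = ((f z $ 1)\<^sup>2 + (f z $ 2)\<^sup>2) / 2"

definition integral_curve ::
    "(real^2 \<Rightarrow> real^2) \<Rightarrow> (real^2) set \<Rightarrow> real set \<Rightarrow> (real \<Rightarrow> real^2) \<Rightarrow> bool" where
  "integral_curve X A I \<gamma> \<longleftrightarrow>
     (\<forall>t\<in>I. \<gamma> t \<in> A \<and> (\<gamma> has_vector_derivative X (\<gamma> t)) (at t))"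

text \<open>The orbit through \<open>p\<close> of the restriction of \<open>X\<close> to an open set \<open>A\<close>. For a \<open>C\<^sup>1\<close> field the
  integral curves through \<open>p\<close> are the restrictions of one maximal integral curve, whose image is
  the union below.\<close>

definition orbit :: "(real^2 \<Rightarrow> real^2) \<Rightarrow> (real^2) set \<Rightarrow> real^2 \<Rightarrow> (real^2) set" where
  "orbit X A p =
     \<Union> {\<gamma> ` I | \<gamma> I. open I \<and> is_interval I \<and> 0 \<in> I \<and> \<gamma> 0 = p \<and> integral_curve X A I \<gamma>}"

definition periodic_orbit :: "(real^2 \<Rightarrow> real^2) \<Rightarrow> (real^2) set \<Rightarrow> (real^2) set \<Rightarrow> bool" where
  "periodic_orbit X A S \<longleftrightarrow>
     (\<exists>\<gamma> T. integral_curve X A UNIV \<gamma> \<and> T > 0 \<and> (\<forall>t. \<gamma> (t + T) = \<gamma> t) \<and>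
            \<not> \<gamma> constant_on UNIV \<and> S = range \<gamma>)"

definition isolated_singular_point :: "(real^2 \<Rightarrow> real^2) \<Rightarrow> (real^2) set \<Rightarrow> real^2 \<Rightarrow> bool" where
  "isolated_singular_point X U z0 \<longleftrightarrow>
     z0 \<in> U \<and> X z0 = 0 \<and> (\<exists>e>0. \<forall>z\<in>U. 0 < dist z z0 \<and> dist z z0 < e \<longrightarrow> X z \<noteq> 0)"

text \<open>The orbits in \<open>V - {z0}\<close> are those of the restriction of \<open>X\<close> to \<open>V - {z0}\<close>, so being periodic
  includes staying in \<open>V\<close>.\<close>

definition is_center :: "(real^2 \<Rightarrow> real^2) \<Rightarrow> (real^2) set \<Rightarrow> real^2 \<Rightarrow> bool" where
  "is_center X U z0 \<longleftrightarrow>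
     isolated_singular_point X U z0 \<and>
     (\<exists>V. open V \<and> z0 \<in> V \<and> V \<subseteq> U \<and>
          (\<forall>p \<in> V - {z0}. periodic_orbit X (V - {z0}) (orbit X (V - {z0}) p)))"

definition filled_with_periodic_orbits ::
    "(real^2 \<Rightarrow> real^2) \<Rightarrow> (real^2) set \<Rightarrow> (real^2) set \<Rightarrow> bool" where
  "filled_with_periodic_orbits X U A \<longleftrightarrow> (\<exists>F. (\<forall>S\<in>F. periodic_orbit X U S) \<and> A = \<Union>F)"

definition periodic_nbhd ::
    "(real^2 \<Rightarrow> real^2) \<Rightarrow> (real^2) set \<Rightarrow> real^2 \<Rightarrow> (real^2) set \<Rightarrow> bool" where
  "periodic_nbhd X U z0 W \<longleftrightarrow>
     open W \<and> connected W \<and> W \<subseteq> U \<and> z0 \<in> W \<and> filled_with_periodic_orbits X U (W - {z0})"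

text \<open>\<open>GREATEST\<close> is with respect to inclusion; a greatest such set exists at every center, see
  \<open>periodic_nbhd_period_annulus\<close> and \<open>period_annulus_greatest\<close>.\<close>

definition period_annulus :: "(real^2 \<Rightarrow> real^2) \<Rightarrow> (real^2) set \<Rightarrow> real^2 \<Rightarrow> (real^2) set" where
  "period_annulus X U z0 = (GREATEST W. periodic_nbhd X U z0 W)"

lemma periodic_orbit_mono: "periodic_orbit X A S \<Longrightarrow> A \<subseteq> B \<Longrightarrow> periodic_orbit X B S"
  unfolding periodic_orbit_def integral_curve_def by (metis subsetD)

lemma periodic_orbit_subset: "periodic_orbit X A S \<Longrightarrow> S \<subseteq> A"
  unfolding periodic_orbit_def integral_curve_def by auto

lemma periodic_orbit_connected:
  assumes "periodic_orbit X A S" shows "connected S"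
proof -
  obtain \<gamma> where g: "integral_curve X A UNIV \<gamma>" "S = range \<gamma>"
    using assms unfolding periodic_orbit_def by auto
  have "continuous_on UNIV \<gamma>"
    using g(1) unfolding integral_curve_def
    by (auto intro!: continuous_at_imp_continuous_on has_vector_derivative_continuous)
  then show ?thesis
    using g(2) connected_continuous_image connected_UNIV by blast
qed

lemma periodic_orbit_orbit_self:
  assumes "periodic_orbit X A (orbit X A p)" shows "p \<in> orbit X A p"
proof -
  have "orbit X A p \<noteq> {}"
    using assms unfolding periodic_orbit_def by force
  then obtain \<gamma> I where "0 \<in> I" "\<gamma> 0 = p" "open I" "is_interval I" "integral_curve X A I \<gamma>"
    unfolding orbit_def by auto
  then show ?thesis
    unfolding orbit_def by blast
qed

lemma periodic_nbhd_Union: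
  assumes "\<W> \<noteq> {}" and W: "\<And>W. W \<in> \<W> \<Longrightarrow> periodic_nbhd X U z0 W"
  shows "periodic_nbhd X U z0 (\<Union>\<W>)"
proof -
  have conn: "connected (\<Union>\<W>)"
    using W by (intro connected_Union) (auto simp: periodic_nbhd_def)
  have "\<forall>W\<in>\<W>. \<exists>F. (\<forall>S\<in>F. periodic_orbit X U S) \<and> W - {z0} = \<Union>F"
    using W by (simp add: periodic_nbhd_def filled_with_periodic_orbits_def)
  then obtain F where F: "\<And>W. W \<in> \<W> \<Longrightarrow> (\<forall>S\<in>F W. periodic_orbit X U S) \<and> W - {z0} = \<Union>(F W)"
    by (metis (no_types))
  have "\<Union>\<W> - {z0} = (\<Union>W\<in>\<W>. W - {z0})"
    by blast
  also have "\<dots> = (\<Union>W\<in>\<W>. \<Union>(F W))"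
    by (rule SUP_cong) (simp_all add: F)
  also have "\<dots> = \<Union>(\<Union>(F ` \<W>))"
    by blast
  finally have "\<Union>\<W> - {z0} = \<Union>(\<Union>(F ` \<W>))" .
  moreover have "\<forall>S \<in> \<Union>(F ` \<W>). periodic_orbit X U S"
    using F by simp
  ultimately have "filled_with_periodic_orbits X U (\<Union>\<W> - {z0})"
    unfolding filled_with_periodic_orbits_def by (intro exI conjI)
  moreover have "open (\<Union>\<W>)" "\<Union>\<W> \<subseteq> U" "z0 \<in> \<Union>\<W>"
    using assms(1) W unfolding periodic_nbhd_def by blast+
  ultimately show ?thesis
    using conn unfolding periodic_nbhd_def by simp
qed

lemma center_imp_periodic_nbhd:
  assumes "is_center X U z0" shows "\<exists>W. periodic_nbhd X U z0 W"
proof -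
  obtain V where V: "open V" "z0 \<in> V" "V \<subseteq> U"
    and per: "\<And>p. p \<in> V - {z0} \<Longrightarrow> periodic_orbit X (V - {z0}) (orbit X (V - {z0}) p)"
    using assms unfolding is_center_def by blast
  define W where "W = connected_component_set V z0"
  have W: "open W" "connected W" "W \<subseteq> V" "z0 \<in> W"
    using V by (auto simp: W_def open_connected_component connected_component_subset)
  let ?O = "orbit X (V - {z0})"
  have sub: "?O p \<subseteq> W - {z0}" if p: "p \<in> W - {z0}" for p
  proof -
    have po: "periodic_orbit X (V - {z0}) (?O p)"
      using per p W by blast
    have pO: "p \<in> ?O p" "connected (?O p)" "?O p \<subseteq> V - {z0}"
      using periodic_orbit_orbit_self[OF po] periodic_orbit_connected[OF po]
        periodic_orbit_subset[OF po] by auto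
    have "connected_component_set V p = W"
      using p connected_component_eq unfolding W_def by blast
    then have "?O p \<subseteq> W"
      using connected_component_maximal[OF pO(1,2), of V] pO(3) by blast
    then show ?thesis using pO by blast
  qed
  have mem: "p \<in> ?O p" if "p \<in> W - {z0}" for p
  proof -
    have "p \<in> V - {z0}" using that W by blast
    then show ?thesis by (intro periodic_orbit_orbit_self per)
  qed
  have "W - {z0} = \<Union>(?O ` (W - {z0}))"
    using sub mem by blast
  moreover have "\<forall>S \<in> ?O ` (W - {z0}). periodic_orbit X U S"
  proof
    fix S assume "S \<in> ?O ` (W - {z0})"
    then obtain p where p: "p \<in> W - {z0}" "S = ?O p" by blast
    then have "periodic_orbit X (V - {z0}) S"
      using per W by blast
    then show "periodic_orbit X U S"
      by (rule periodic_orbit_mono) (use V in blast)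
  qed
  ultimately have "filled_with_periodic_orbits X U (W - {z0})"
    unfolding filled_with_periodic_orbits_def by (intro exI conjI)
  then show ?thesis
    using W V unfolding periodic_nbhd_def by (meson subset_trans)
qed

lemma
  assumes "is_center X U z0"
  shows periodic_nbhd_period_annulus: "periodic_nbhd X U z0 (period_annulus X U z0)"
    and period_annulus_greatest: "\<And>W. periodic_nbhd X U z0 W \<Longrightarrow> W \<subseteq> period_annulus X U z0"
proof -
  let ?P = "\<Union>{W. periodic_nbhd X U z0 W}"
  have P: "periodic_nbhd X U z0 ?P"
    using center_imp_periodic_nbhd[OF assms] by (intro periodic_nbhd_Union) auto
  have "period_annulus X U z0 = ?P"
    unfolding period_annulus_def by (rule Greatest_equality) (use P in blast)+
  then show "periodic_nbhd X U z0 (period_annulus X U z0)"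
    and "\<And>W. periodic_nbhd X U z0 W \<Longrightarrow> W \<subseteq> period_annulus X U z0"
    using P by auto
qed

end

theory Submission
  imports Defs
begin

text \<open>With \<open>J\<close> the quarter turn, \<open>Df X = (det Df) J f\<close>, so \<open>f\<close> maps integral curves of \<open>X\<close> to
  curves that run around circles centered at \<open>0\<close> with nonvanishing angular velocity. If \<open>f\<close> has a
  right inverse \<open>g\<close> on a disc, then \<open>g\<close> maps each circle in the disc, suitably reparametrized, to
  a periodic orbit. Conversely take \<open>g\<close> with \<open>g 0 = z0\<close> on the largest possible disc, and suppose
  that a neighborhood \<open>W\<close> of \<open>z0\<close> filled with periodic orbits is not contained in the image of
  \<open>g\<close>. Then \<open>W\<close> contains a boundary point of this image, which lies over the bounding circle of
  the disc. Its periodic orbit stays in the boundary and covers the whole circle, so \<open>g\<close> extends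
  to a larger disc, a contradiction.\<close>

section \<open>Periodic angular velocities\<close>

text \<open>Integrates the angular velocity of a given orbit to an angle and, in the other
  direction, the reciprocal velocity along a circle to a time.\<close>

lemma antiderivative_on_line:
  fixes a :: "real \<Rightarrow> real"
  assumes "continuous_on UNIV a"
  obtains F where "\<And>x. (F has_real_derivative a x) (at x)"
proof -
  have "\<exists>F. \<forall>x::real. (-\<infinity>::ereal) < x \<longrightarrow> x < (\<infinity>::ereal) \<longrightarrow> (F has_vector_derivative a x) (at x)"
    by (rule einterval_antiderivative)
      (use assms continuous_on_eq_continuous_at in auto)
  then show ?thesis
    using that by (auto simp: has_real_derivative_iff_has_vector_derivative)
qed

text \<open>The values at the integer multiples of \<open>L\<close> form an arithmetic progression
  with step \<open>c\<close>, unbounded in both directions; the intermediate value theorem fills the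
  gaps.\<close>

lemma continuous_quasiperiodic_surj:
  fixes F :: "real \<Rightarrow> real"
  assumes cont: "continuous_on UNIV F" and per: "\<And>x. F (x + L) = F x + c" and "c \<noteq> 0"
  shows "surj F"
proof -
  have mult: "F (x + of_int k * L) = F x + of_int k * c" for k x
  proof (induction k rule: int_induct[where k=0])
    case base then show ?case by simp
  next
    case (step1 i)
    then show ?case using per[of "x + of_int i * L"] by (simp add: algebra_simps)
  next
    case (step2 i)
    then show ?case using per[of "x + of_int (i - 1) * L"] by (simp add: algebra_simps)
  qed
  have "y \<in> range F" for y
  proof -
    \<comment> \<open>\<open>y\<close> lies between the values of \<open>F\<close> at
      \<open>of_int m * L\<close> and \<open>of_int (m + 1) * L\<close>; the sign of
      \<open>c\<close> decides which of the two is larger.\<close>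
    define m where "m = \<lfloor>(y - F 0) / c\<rfloor>"
    have b: "of_int m \<le> (y - F 0) / c" "(y - F 0) / c \<le> of_int (m + 1)"
      unfolding m_def by linarith+
    have F: "F (of_int k * L) = F 0 + of_int k * c" for k
      using mult[of 0 k] by simp
    have iv: "is_interval (range F)"
      using connected_continuous_image[OF cont connected_UNIV] is_interval_connected_1 by blast
    have betw: "of_int m * c \<le> y - F 0 \<and> y - F 0 \<le> of_int (m + 1) * c \<or>
          of_int (m + 1) * c \<le> y - F 0 \<and> y - F 0 \<le> of_int m * c"
      using b \<open>c \<noteq> 0\<close> by (cases "c > 0") (auto simp: field_simps)
    then have "F (of_int m * L) \<le> y \<and> y \<le> F (of_int (m + 1) * L) \<or>
          F (of_int (m + 1) * L) \<le> y \<and> y \<le> F (of_int m * L)"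
      unfolding F by linarith
    then show ?thesis
      using iv unfolding is_interval_1 by blast
  qed
  then show ?thesis by blast
qed

text \<open>Rolle's theorem makes \<open>F\<close> injective whatever the sign of \<open>a\<close>.
  The increment over one period has derivative zero, hence is a constant \<open>c\<close>, which is
  nonzero by injectivity; surjectivity then follows from quasiperiodicity.\<close>

lemma antiderivative_periodic_nonvanishing:
  fixes a F :: "real \<Rightarrow> real"
  assumes nz: "\<And>x. a x \<noteq> 0" and per: "\<And>x. a (x + L) = a x" and "L \<noteq> 0"
    and F: "\<And>x. (F has_real_derivative a x) (at x)"
  obtains c where "c \<noteq> 0" "\<And>x. F (x + L) = F x + c" "bij F"
proof -
  have cF: "continuous_on S F" for S
    using F DERIV_continuous_on has_field_derivative_at_within by blast
  have inj: "F x \<noteq> F y" if "x < y" for x y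
  proof
    assume "F x = F y"
    then obtain z where "x < z" "(F has_real_derivative 0) (at z)"
      using Rolle[OF \<open>x < y\<close> _ cF] F by (metis real_differentiable_def)
    then show False using DERIV_unique[OF F] nz by blast
  qed
  have "inj F"
    by (rule linorder_injI) (use inj in blast)
  define c where "c = F L - F 0"
  have c: "c \<noteq> 0"
    using \<open>inj F\<close> \<open>L \<noteq> 0\<close> unfolding c_def inj_def by fastforce
  have "((\<lambda>x. F (x + L) - F x) has_real_derivative 0) (at x)" for x
    by (rule derivative_eq_intros refl F F[THEN DERIV_chain2] | simp add: per)+
  then have "F (x + L) - F x = F (0 + L) - F 0" for x
    using DERIV_isconst_all[of "\<lambda>x. F (x + L) - F x" x 0] by blast
  then have q: "F (x + L) = F x + c" for x
    unfolding c_def by (metis add.commute add_0 diff_add_cancel)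
  show ?thesis
    using that[OF c q] continuous_quasiperiodic_surj[OF cF q c] \<open>inj F\<close> by (auto simp: bij_def)
qed

section \<open>Polar coordinates\<close>

definition unit_vec :: "real \<Rightarrow> real^2" where
  "unit_vec t = vector [cos t, sin t]"

definition quarter_turn :: "real^2 \<Rightarrow> real^2" where
  "quarter_turn v = vector [- (v $ 2), v $ 1]"

lemma unit_vec_nth [simp]: "unit_vec t $ 1 = cos t" "unit_vec t $ 2 = sin t"
  by (simp_all add: unit_vec_def)

lemma quarter_turn_nth [simp]: "quarter_turn v $ 1 = - (v $ 2)" "quarter_turn v $ 2 = v $ 1"
  by (simp_all add: quarter_turn_def)

lemma inner_quarter_turn [simp]: "inner v (quarter_turn v) = 0" "inner (quarter_turn v) v = 0"
  by (simp_all add: inner_vec_def sum_2)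

lemma norm_unit_vec [simp]: "norm (unit_vec t) = 1"
  by (simp add: norm_eq_1 inner_vec_def sum_2 unit_vec_def flip: power2_eq_square)

lemma unit_vec_periodic: "unit_vec (t + 2 * pi) = unit_vec t"
  by (simp add: unit_vec_def)

lemma polar_form:
  obtains t where "v = norm v *\<^sub>R unit_vec t"
proof (cases "v = 0")
  case True then show ?thesis using that by simp
next
  case False
  have "(v $ 1)\<^sup>2 + (v $ 2)\<^sup>2 = (norm v)\<^sup>2"
    unfolding power2_norm_eq_inner by (simp add: inner_vec_def sum_2 power2_eq_square)
  then have "(v $ 1 / norm v)\<^sup>2 + (v $ 2 / norm v)\<^sup>2 = 1"
    using False by (simp add: power_divide flip: add_divide_distrib)
  then obtain t where t: "v $ 1 / norm v = cos t" "v $ 2 / norm v = sin t"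
    using sincos_total_2pi by blast
  have "v $ 1 = norm v * cos t" "v $ 2 = norm v * sin t"
    using False by (simp_all flip: t)
  then have "v = norm v *\<^sub>R unit_vec t"
    unfolding vec_eq_iff[of v] forall_2 by simp
  then show ?thesis using that by blast
qed

lemma has_vector_derivative_unit_vec:
  assumes "(\<theta> has_real_derivative a) (at t)"
  shows "((\<lambda>t. \<rho> *\<^sub>R unit_vec (\<theta> t)) has_vector_derivative
            a *\<^sub>R quarter_turn (\<rho> *\<^sub>R unit_vec (\<theta> t))) (at t)"
proof -
  have "((\<lambda>t. \<rho> * cos (\<theta> t)) has_real_derivative - (\<rho> * sin (\<theta> t) * a)) (at t)"
    "((\<lambda>t. \<rho> * sin (\<theta> t)) has_real_derivative \<rho> * cos (\<theta> t) * a) (at t)"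
    using assms by (auto intro!: derivative_eq_intros)
  \<comment> \<open>The curve is split along the two axes, so that the scalar derivatives just found
    apply to each component.\<close>
  note this[THEN has_vector_derivative_scaleR, OF has_vector_derivative_const]
  from has_vector_derivative_add[OF this(1)[of "axis 1 1 :: real^2"] this(2)[of "axis 2 1"]]
  have "((\<lambda>t. (\<rho> * cos (\<theta> t)) *\<^sub>R axis 1 1 + (\<rho> * sin (\<theta> t)) *\<^sub>R axis 2 1 :: real^2) has_vector_derivative
           (- (\<rho> * sin (\<theta> t) * a)) *\<^sub>R axis 1 1 + (\<rho> * cos (\<theta> t) * a) *\<^sub>R axis 2 1) (at t)"
    by simp
  moreover have "\<rho> *\<^sub>R unit_vec u = (\<rho> * cos u) *\<^sub>R axis 1 1 + (\<rho> * sin u) *\<^sub>R axis 2 1" for u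
    unfolding vec_eq_iff forall_2 by (simp add: axis_def)
  moreover have "a *\<^sub>R quarter_turn (\<rho> *\<^sub>R unit_vec (\<theta> t)) =
      (- (\<rho> * sin (\<theta> t) * a)) *\<^sub>R axis 1 1 + (\<rho> * cos (\<theta> t) * a) *\<^sub>R axis 2 1"
    unfolding vec_eq_iff forall_2 by (simp add: axis_def mult_ac)
  ultimately show ?thesis by simp
qed

text \<open>The velocity is orthogonal to the position, so \<open>inner (w t) (w t)\<close> has
  derivative zero.\<close>

lemma norm_rotating_curve:
  assumes w: "\<And>t. t \<in> I \<Longrightarrow> (w has_vector_derivative a t *\<^sub>R quarter_turn (w t)) (at t)"
    and "is_interval I" "t0 \<in> I" "t \<in> I"
  shows "norm (w t) = norm (w t0)"
proof -
  have "convex I" using assms is_interval_convex by blast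
  have "((\<lambda>t. inner (w t) (w t)) has_vector_derivative 0) (at t within I)" if "t \<in> I" for t
  proof -
    have "((\<lambda>t. inner (w t) (w t)) has_derivative
        (\<lambda>h. inner (w t) (h *\<^sub>R (a t *\<^sub>R quarter_turn (w t))) + inner (h *\<^sub>R (a t *\<^sub>R quarter_turn (w t))) (w t)))
        (at t within I)"
      using has_derivative_at_withinI[OF w[OF that, unfolded has_vector_derivative_def]]
      by (intro has_derivative_inner)
    then show ?thesis
      by (simp add: has_vector_derivative_def)
  qed
  then obtain c where "\<And>t. t \<in> I \<Longrightarrow> inner (w t) (w t) = c"
    using has_vector_derivative_zero_constant[OF \<open>convex I\<close>, of "\<lambda>t. inner (w t) (w t)"] by blast
  then show ?thesis
    using assms by (simp add: norm_eq_sqrt_inner)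
qed

text \<open>Uniqueness for a linear differential equation, obtained from conservation of the norm:
  the difference \<open>v\<close> of the two curves rotates with the same velocity \<open>a\<close>
  and vanishes at \<open>t0\<close>.\<close>

lemma rotating_curve_angle:
  assumes w: "\<And>t. (w has_vector_derivative a t *\<^sub>R quarter_turn (w t)) (at t)"
    and \<theta>: "\<And>t. (\<theta> has_real_derivative a t) (at t)"
    and w0: "w t0 = \<rho> *\<^sub>R unit_vec (\<theta> t0 + \<alpha>)"
  shows "w t = \<rho> *\<^sub>R unit_vec (\<theta> t + \<alpha>)"
proof -
  define v where "v t = w t - \<rho> *\<^sub>R unit_vec (\<theta> t + \<alpha>)" for t
  have \<theta>\<alpha>: "((\<lambda>t. \<theta> t + \<alpha>) has_real_derivative a t) (at t)" for t
    using \<theta> by (auto intro!: derivative_eq_intros)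
  have "(v has_vector_derivative a t *\<^sub>R quarter_turn (v t)) (at t)" for t
  proof -
    have lin: "quarter_turn (x - y) = quarter_turn x - quarter_turn y" for x y
      by (simp add: quarter_turn_def vec_eq_iff forall_2)
    show ?thesis
      unfolding v_def[abs_def] lin scaleR_diff_right
      by (intro has_vector_derivative_diff w has_vector_derivative_unit_vec \<theta>\<alpha>)
  qed
  then have "norm (v t) = norm (v t0)"
    using norm_rotating_curve[of UNIV v a t0 t] by simp
  then show ?thesis by (simp add: v_def w0)
qed

text \<open>The angle is an antiderivative of a periodic nonvanishing function, so it takes every
  real value and the curve passes through every direction.\<close>

lemma rotating_curve_surj:
  assumes w: "\<And>t. (w has_vector_derivative a t *\<^sub>R quarter_turn (w t)) (at t)"
    and a: "continuous_on UNIV a" "\<And>t. a t \<noteq> 0" "\<And>t. a (t + T) = a t" and "T \<noteq> 0"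
  shows "sphere 0 (norm (w t0)) \<subseteq> range w"
proof
  fix v :: "real^2" assume v: "v \<in> sphere 0 (norm (w t0))"
  obtain \<theta> where \<theta>: "\<And>t. (\<theta> has_real_derivative a t) (at t)"
    using antiderivative_on_line a(1) by blast
  have "bij \<theta>"
    using antiderivative_periodic_nonvanishing[OF a(2,3) \<open>T \<noteq> 0\<close> \<theta>] by blast
  obtain \<phi> where \<phi>: "v = norm v *\<^sub>R unit_vec \<phi>"
    by (rule polar_form)
  obtain \<beta> where \<beta>: "w t0 = norm (w t0) *\<^sub>R unit_vec \<beta>"
    by (rule polar_form)
  \<comment> \<open>The phase that makes \<open>\<theta> t0 + \<alpha>\<close> the polar angle
    \<open>\<beta>\<close> of \<open>w t0\<close>.\<close>
  define \<alpha> where "\<alpha> = \<beta> - \<theta> t0"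
  have "w t = norm (w t0) *\<^sub>R unit_vec (\<theta> t + \<alpha>)" for t
    by (rule rotating_curve_angle[OF w \<theta>, where ?t0.0 = t0]) (simp add: \<alpha>_def flip: \<beta>)
  moreover obtain t where "\<theta> t = \<phi> - \<alpha>"
    using \<open>bij \<theta>\<close> bij_pointE by metis
  moreover have "norm (w t0) = norm v" using v by simp
  ultimately have "w t = norm v *\<^sub>R unit_vec \<phi>" by simp
  then have "w t = v" using \<phi> by metis
  then show "v \<in> range w" by blast
qed

section \<open>The field of a local diffeomorphism of the plane\<close>

locale plane_local_diffeo =
  fixes U :: "(real^2) set" and f :: "real^2 \<Rightarrow> real^2" and f' :: "real^2 \<Rightarrow> ((real^2) \<Rightarrow>\<^sub>L (real^2))"
  assumes open_U: "open U"
    and deriv_f: "z \<in> U \<Longrightarrow> (f has_derivative blinfun_apply (f' z)) (at z)"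
    and cont_f': "continuous_on U f'"
    and det_nz: "z \<in> U \<Longrightarrow> jacobian_det f z \<noteq> 0"
begin

abbreviation "X \<equiv> hamiltonian_field (half_sq_norm f)"

lemma jacobian_det_eq:
  assumes "z \<in> U"
  shows "jacobian_det f z = f' z (axis 1 1) $ 1 * f' z (axis 2 1) $ 2 - f' z (axis 2 1) $ 1 * f' z (axis 1 1) $ 2"
  using frechet_derivative_at[OF deriv_f[OF assms]]
  by (simp add: jacobian_det_def det_2 matrix_def)

lemma continuous_on_jacobian_det: "continuous_on U (jacobian_det f)"
proof -
  have "continuous_on U (\<lambda>z. f' z (axis 1 1) $ 1 * f' z (axis 2 1) $ 2 - f' z (axis 2 1) $ 1 * f' z (axis 1 1) $ 2)"
    by (intro continuous_intros cont_f')
  then show ?thesis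
    by (rule continuous_on_eq) (simp add: jacobian_det_eq)
qed

lemma continuous_on_f: "continuous_on U f"
  using deriv_f has_derivative_continuous by (fastforce intro: continuous_at_imp_continuous_on)

lemma f'_expand: "f' z v = (v $ 1) *\<^sub>R f' z (axis 1 1) + (v $ 2) *\<^sub>R f' z (axis 2 1)"
proof -
  have "v = (v $ 1) *\<^sub>R axis 1 1 + (v $ 2) *\<^sub>R axis 2 1"
    by (simp add: vec_eq_iff forall_2 axis_def)
  then show ?thesis
    by (metis blinfun.add_right blinfun.scaleR_right)
qed

lemma bij_f':
  assumes "z \<in> U" shows "bij (blinfun_apply (f' z))"
proof -
  have l: "linear (blinfun_apply (f' z))"
    by (simp add: blinfun.bounded_linear_right bounded_linear.linear)
  have "det (matrix (blinfun_apply (f' z))) \<noteq> 0"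
    using frechet_derivative_at[OF deriv_f[OF assms]] det_nz[OF assms]
    by (simp add: jacobian_det_def)
  then have "inj (blinfun_apply (f' z))"
    using l det_nz_iff_inj by blast
  then show ?thesis
    using l linear_injective_imp_surjective by (auto simp: bij_def)
qed

text \<open>Uses \<open>\<nabla>H = Df\<^sup>T f\<close> and \<open>Df J Df\<^sup>T = (det Df) J\<close>.\<close>

lemma f'_X:
  assumes "z \<in> U"
  shows "f' z (X z) = jacobian_det f z *\<^sub>R quarter_turn (f z)"
proof -
  have "(half_sq_norm f has_derivative (\<lambda>h. f z $ 1 * f' z h $ 1 + f z $ 2 * f' z h $ 2)) (at z)"
    unfolding half_sq_norm_def[abs_def]
    by (rule derivative_eq_intros bounded_linear.has_derivative[OF bounded_linear_vec_nth] deriv_f[OF assms] refl | simp add: fun_eq_iff algebra_simps)+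
  note fd = frechet_derivative_at[OF this, symmetric]
  have p: "partial_deriv i (half_sq_norm f) z = f z $ 1 * f' z (axis i 1) $ 1 + f z $ 2 * f' z (axis i 1) $ 2" for i
    by (simp add: partial_deriv_def fd)
  show ?thesis
    unfolding f'_expand[of z "X z"] vec_eq_iff forall_2
    by (simp add: hamiltonian_field_def p jacobian_det_eq[OF assms] algebra_simps)
qed

text \<open>The derivative is injective and, by \<open>f'_X\<close>, sends \<open>X z\<close> to a
  nonzero multiple of the quarter turn of \<open>f z\<close>.\<close>

lemma X_eq_0_iff:
  assumes "z \<in> U" shows "X z = 0 \<longleftrightarrow> f z = 0"
proof -
  have "X z = 0 \<longleftrightarrow> f' z (X z) = 0"
    by (metis assms bij_f' bij_def blinfun.zero_right injD)
  also have "\<dots> \<longleftrightarrow> f z = 0"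
    using det_nz[OF assms] by (auto simp: f'_X[OF assms] quarter_turn_def vec_eq_iff forall_2)
  finally show ?thesis .
qed

text \<open>The chain rule with \<open>f'_X\<close>; this brings integral curves under the lemmas on
  rotating curves, with the Jacobian determinant as angular velocity.\<close>

lemma integral_curve_image_rotates:
  assumes "integral_curve X A I \<gamma>" "A \<subseteq> U" "t \<in> I"
  shows "((f \<circ> \<gamma>) has_vector_derivative jacobian_det f (\<gamma> t) *\<^sub>R quarter_turn ((f \<circ> \<gamma>) t)) (at t)"
proof -
  have g: "\<gamma> t \<in> U" "(\<gamma> has_vector_derivative X (\<gamma> t)) (at t)"
    using assms unfolding integral_curve_def by auto
  have "((f \<circ> \<gamma>) has_vector_derivative f' (\<gamma> t) (X (\<gamma> t))) (at t)"
    using vector_derivative_diff_chain_within[of \<gamma> _ t UNIV f "f' (\<gamma> t)"] g deriv_f[OF g(1)]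
    by (simp add: has_derivative_at_withinI)
  then show ?thesis
    using f'_X[OF g(1)] by simp
qed

lemma local_homeomorphism:
  assumes "z \<in> U"
  obtains N W h where "open N" "N \<subseteq> U" "z \<in> N" "open W" "homeomorphism N W f h"
proof -
  \<comment> \<open>The inverse function theorem is applied with a bounded left inverse of the
    derivative; linear maps of the plane are bounded.\<close>
  define invf where "invf = Blinfun (inv (blinfun_apply (f' z)))"
  have l: "linear (blinfun_apply (f' z))"
    by (simp add: blinfun.bounded_linear_right bounded_linear.linear)
  have "linear (inv (blinfun_apply (f' z)))"
    using bij_f'[OF assms] l by (metis bij_def inj_linear_imp_inv_linear)
  then have "blinfun_apply invf = inv (blinfun_apply (f' z))"
    unfolding invf_def by (simp add: bounded_linear_Blinfun_apply linear_conv_bounded_linear)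
  then have "invf o\<^sub>L f' z = id_blinfun"
    using bij_f'[OF assms] by (intro blinfun_eqI) (simp add: bij_def)
  from inverse_function_theorem[OF open_U deriv_f cont_f' assms this] that
  show ?thesis by metis
qed

section \<open>Lifts through the local diffeomorphism\<close>

text \<open>Continuous sections of \<open>f\<close> stand in for the sets on which \<open>f\<close>
  is injective: sections over concentric discs with the same value at the center agree where both
  are defined, so they can be compared and glued.\<close>

definition lift_on :: "(real^2) set \<Rightarrow> (real^2 \<Rightarrow> real^2) \<Rightarrow> bool" where
  "lift_on B g \<longleftrightarrow> continuous_on B g \<and> g ` B \<subseteq> U \<and> (\<forall>w\<in>B. f (g w) = w)"

lemma lift_onD:
  assumes "lift_on B g"
  shows "continuous_on B g" "w \<in> B \<Longrightarrow> g w \<in> U" "w \<in> B \<Longrightarrow> f (g w) = w" "inj_on g B" "inj_on f (g ` B)" "f ` g ` B = B"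
proof -
  show "continuous_on B g" and *: "\<And>w. w \<in> B \<Longrightarrow> g w \<in> U" "\<And>w. w \<in> B \<Longrightarrow> f (g w) = w"
    using assms by (auto simp: lift_on_def)
  show "inj_on g B" by (rule inj_on_inverseI[of _ f]) (rule *)
  show "inj_on f (g ` B)" "f ` g ` B = B"
    using * by (auto simp: inj_on_def image_iff)
qed

lemma lift_on_cong: "lift_on B g \<Longrightarrow> (\<And>w. w \<in> B \<Longrightarrow> g w = h w) \<Longrightarrow> lift_on B h"
  unfolding lift_on_def by (metis (no_types, lifting) continuous_on_cong image_cong)

lemma lift_on_subset: "lift_on B g \<Longrightarrow> C \<subseteq> B \<Longrightarrow> lift_on C g"
  unfolding lift_on_def using continuous_on_subset by blast

lemma open_lift_image: "lift_on B g \<Longrightarrow> open B \<Longrightarrow> open (g ` B)"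
  by (intro invariance_of_domain lift_onD)

text \<open>The coincidence set is closed by continuity, and open because \<open>f\<close> is
  injective near a common value of \<open>g\<close> and \<open>h\<close>.\<close>

lemma lift_unique:
  assumes g: "lift_on B g" and h: "lift_on B h" and "connected B"
    and "w0 \<in> B" "g w0 = h w0" "w \<in> B"
  shows "g w = h w"
proof -
  let ?S = "{w \<in> B. g w = h w}"
  have "closedin (top_of_set B) {w \<in> B. g w - h w = 0}"
    by (intro continuous_closedin_preimage_constant continuous_intros lift_onD(1)[OF g] lift_onD(1)[OF h])
  then have cl: "closedin (top_of_set B) ?S" by simp
  have op: "openin (top_of_set B) ?S"
  proof (subst openin_subopen, intro ballI)
    fix x assume x: "x \<in> ?S"
    have "g x \<in> U" using lift_onD(2)[OF g, of x] x by simp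
    then obtain N W k where N: "open N" "g x \<in> N" and "homeomorphism N W f k"
      by (rule local_homeomorphism)
    then have inj: "inj_on f N"
      by (intro inj_on_inverseI[of N k]) (simp add: homeomorphism_apply1)
    have "openin (top_of_set B) ((B \<inter> g -` N) \<inter> (B \<inter> h -` N))"
      by (intro openin_Int continuous_openin_preimage_gen lift_onD(1)[OF g] lift_onD(1)[OF h] N)
    moreover have "x \<in> (B \<inter> g -` N) \<inter> (B \<inter> h -` N)"
      using x N by auto
    moreover have "(B \<inter> g -` N) \<inter> (B \<inter> h -` N) \<subseteq> ?S"
    proof
      fix y assume y: "y \<in> (B \<inter> g -` N) \<inter> (B \<inter> h -` N)"
      then have "f (g y) = f (h y)"
        using lift_onD(3)[OF g] lift_onD(3)[OF h] by auto
      then show "y \<in> ?S" using y inj_onD[OF inj] by auto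
    qed
    ultimately show "\<exists>T. openin (top_of_set B) T \<and> x \<in> T \<and> T \<subseteq> ?S" by blast
  qed
  have "?S = {} \<or> ?S = B"
    using \<open>connected B\<close> op cl unfolding connected_clopen by blast
  then show ?thesis using assms by blast
qed

lemma lift_glue:
  assumes "\<And>i. i \<in> I \<Longrightarrow> open (B i)" and l: "\<And>i. i \<in> I \<Longrightarrow> lift_on (B i) (g i)"
    and agree: "\<And>i j w. i \<in> I \<Longrightarrow> j \<in> I \<Longrightarrow> w \<in> B i \<Longrightarrow> w \<in> B j \<Longrightarrow> g i w = g j w"
  obtains G where "lift_on (\<Union>i\<in>I. B i) G" "\<And>i w. i \<in> I \<Longrightarrow> w \<in> B i \<Longrightarrow> G w = g i w"
proof -
  \<comment> \<open>Any index whose domain contains \<open>w\<close> will do; by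
    \<open>agree\<close> the value does not depend on the choice.\<close>
  define G where "G w = g (SOME i. i \<in> I \<and> w \<in> B i) w" for w
  have G: "G w = g i w" if "i \<in> I" "w \<in> B i" for i w
  proof -
    have "(SOME i. i \<in> I \<and> w \<in> B i) \<in> I \<and> w \<in> B (SOME i. i \<in> I \<and> w \<in> B i)"
      using that by (intro someI[of "\<lambda>i. i \<in> I \<and> w \<in> B i"]) auto
    then show ?thesis unfolding G_def using agree that by blast
  qed
  have lG: "lift_on (B i) G" if "i \<in> I" for i
    using lift_on_cong[OF l[OF that]] G[OF that] by metis
  have "continuous_on (\<Union>i\<in>I. B i) G"
    using assms(1) lift_onD(1)[OF lG] by (intro continuous_on_open_UN) auto
  then have "lift_on (\<Union>i\<in>I. B i) G"
    using lG unfolding lift_on_def by blast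
  then show ?thesis using that G by blast
qed

lemma lift_has_derivative:
  assumes g: "lift_on B g" and "open B" "w \<in> B"
  shows "(g has_derivative inv (blinfun_apply (f' (g w)))) (at w)"
proof (rule has_derivative_inverse_basic)
  have z: "g w \<in> U" using lift_onD(2)[OF g] assms by blast
  show "(f has_derivative blinfun_apply (f' (g w))) (at (g w))"
    by (rule deriv_f[OF z])
  have "linear (blinfun_apply (f' (g w)))"
    by (simp add: blinfun.bounded_linear_right bounded_linear.linear)
  then show "bounded_linear (inv (blinfun_apply (f' (g w))))"
    using bij_f'[OF z] by (metis bij_def inj_linear_imp_inv_linear linear_conv_bounded_linear)
  show "inv (blinfun_apply (f' (g w))) \<circ> blinfun_apply (f' (g w)) = id"
    using bij_f'[OF z] by (simp add: bij_def)
  show "continuous (at w) g"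
    using lift_onD(1)[OF g] assms by (simp add: continuous_on_eq_continuous_at)
qed (use assms lift_onD(3)[OF g] in auto)

text \<open>A sequence in the image that tends to \<open>z\<close> has the form
  \<open>g (f (x n))\<close>, hence also tends to \<open>g (f z)\<close>. Thus points of
  \<open>U\<close> on the boundary of the image of an open \<open>B\<close> lie over points outside
  \<open>B\<close>.\<close>

lemma lift_image_closure:
  assumes g: "lift_on B g" and z: "z \<in> U" "z \<in> closure (g ` B)" "f z \<in> B"
  shows "z \<in> g ` B"
proof -
  obtain x where x: "\<And>n. x n \<in> g ` B" "x \<longlonglongrightarrow> z"
    using z(2) unfolding closure_sequential by blast
  have "isCont f z"
    using deriv_f[OF z(1)] has_derivative_continuous by blast
  then have fx: "(\<lambda>n. f (x n)) \<longlonglongrightarrow> f z"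
    using x(2) isCont_tendsto_compose by blast
  have "f (x n) \<in> B" "g (f (x n)) = x n" for n
    using x(1)[of n] lift_onD(3)[OF g] by auto
  then have "x \<longlonglongrightarrow> g (f z)"
    using continuous_on_tendsto_compose[OF lift_onD(1)[OF g] fx z(3)] by simp
  then show ?thesis
    using LIMSEQ_unique[OF x(2)] z(3) by blast
qed

text \<open>Turns a set on which \<open>f\<close> is injective into a lift; continuity of the
  inverse rests on invariance of domain.\<close>

lemma lift_inv_into:
  assumes "open V" "V \<subseteq> U" "inj_on f V"
  shows "lift_on (f ` V) (inv_into V f)"
proof -
  have "continuous_on V f" using assms continuous_on_f continuous_on_subset by blast
  then have "continuous_on (f ` V) (inv_into V f)"
    using assms by (intro continuous_on_inverse_open) auto
  then show ?thesis
    using assms by (auto simp: lift_on_def f_inv_into_f inv_into_into subset_iff)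
qed

lemma local_lift:
  assumes "z \<in> U"
  obtains \<epsilon> h where "\<epsilon> > 0" "lift_on (ball (f z) \<epsilon>) h" "h (f z) = z"
proof -
  obtain N W h where N: "open N" "N \<subseteq> U" "z \<in> N" "open W" "homeomorphism N W f h"
    using local_homeomorphism[OF assms] .
  then have "f z \<in> W" by (auto simp: homeomorphism_def)
  then obtain \<epsilon> where e: "\<epsilon> > 0" "ball (f z) \<epsilon> \<subseteq> W"
    using N(4) open_contains_ball by blast
  have "lift_on W h" using N by (auto simp: homeomorphism_def lift_on_def)
  then have "lift_on (ball (f z) \<epsilon>) h" using e lift_on_subset by blast
  moreover have "h (f z) = z" using N by (auto simp: homeomorphism_def)
  ultimately show ?thesis using that e by blast
qed

section \<open>Images of circles are periodic orbits\<close>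

text \<open>Along an integral curve over the circle the angle must satisfy
  \<open>\<theta>' = D \<theta>\<close>. So time is an antiderivative \<open>\<tau>\<close> of
  \<open>1 / D\<close> as a function of the angle, and \<open>\<theta>\<close> is its inverse.
  Removing the zeros of \<open>f\<close> makes the result fit the punctured neighborhood in the
  definition of a center.\<close>

lemma periodic_orbit_lift_sphere:
  assumes g: "lift_on B g" and "open B" and B: "sphere 0 \<rho> \<subseteq> B" and "\<rho> > 0"
  shows "periodic_orbit X (g ` B - {z. f z = 0}) (g ` sphere 0 \<rho>)"
proof -
  define c where "c \<theta> = \<rho> *\<^sub>R unit_vec \<theta>" for \<theta>
  define D where "D \<theta> = jacobian_det f (g (c \<theta>))" for \<theta>
  have cB: "c \<theta> \<in> B" for \<theta>
    using B \<open>\<rho> > 0\<close> by (auto simp: c_def)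
  have c_range: "c ` UNIV = sphere 0 \<rho>"
  proof
    show "c ` UNIV \<subseteq> sphere 0 \<rho>" using \<open>\<rho> > 0\<close> by (auto simp: c_def)
    show "sphere 0 \<rho> \<subseteq> c ` UNIV"
    proof
      fix v :: "real^2" assume v: "v \<in> sphere 0 \<rho>"
      obtain t where "v = norm v *\<^sub>R unit_vec t" by (rule polar_form)
      moreover have "norm v = \<rho>" using v by simp
      ultimately show "v \<in> c ` UNIV" unfolding c_def by auto
    qed
  qed
  have per: "c (\<theta> + 2 * pi) = c \<theta>" for \<theta>
    by (simp add: c_def unit_vec_periodic)
  have "((\<lambda>t. c t) has_vector_derivative 1 *\<^sub>R quarter_turn (c t)) (at t)" for t
    unfolding c_def by (rule has_vector_derivative_unit_vec) (rule DERIV_ident)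
  then have contc: "continuous_on UNIV c"
    using has_vector_derivative_continuous by (blast intro: continuous_at_imp_continuous_on)
  have gU: "g (c \<theta>) \<in> U" for \<theta>
    using lift_onD(2)[OF g] cB by blast
  have contD: "continuous_on UNIV D"
    unfolding D_def
    by (intro continuous_on_compose2[OF continuous_on_jacobian_det]
        continuous_on_compose2[OF lift_onD(1)[OF g]] contc) (use cB gU in auto)
  have D0: "D \<theta> \<noteq> 0" for \<theta>
    unfolding D_def using det_nz gU by blast
  have cont_inv: "continuous_on UNIV (\<lambda>\<theta>. 1 / D \<theta>)"
    using contD D0 by (intro continuous_intros) auto
  obtain \<tau> where \<tau>: "\<And>\<theta>. (\<tau> has_real_derivative 1 / D \<theta>) (at \<theta>)"
    using antiderivative_on_line[OF cont_inv] by blast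
  \<comment> \<open>\<open>T\<close> is the signed time of one full turn.\<close>
  obtain T where T: "T \<noteq> 0" "\<And>\<theta>. \<tau> (\<theta> + 2 * pi) = \<tau> \<theta> + T" "bij \<tau>"
    by (rule antiderivative_periodic_nonvanishing[of "\<lambda>\<theta>. 1 / D \<theta>" "2 * pi" \<tau>])
      (use D0 \<tau> per in \<open>auto simp: D_def\<close>)
  define \<theta> where "\<theta> = inv \<tau>"
  have \<tau>\<theta>: "\<tau> (\<theta> t) = t" and \<theta>\<tau>: "\<theta> (\<tau> s) = s" for s t
    using T(3) by (simp_all add: \<theta>_def bij_is_inj bij_is_surj surj_f_inv_f)
  have "continuous_on UNIV \<tau>"
    using \<tau> DERIV_isCont by (blast intro: continuous_at_imp_continuous_on)
  then have "continuous_on (range \<tau>) \<theta>"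
    using T(3) unfolding \<theta>_def by (intro continuous_on_inverse_open) (auto simp: bij_def)
  then have cont\<theta>: "isCont \<theta> t" for t
    using T(3) by (simp add: bij_def continuous_on_eq_continuous_at)
  have \<theta>': "(\<theta> has_real_derivative D (\<theta> t)) (at t)" for t
  proof -
    have "(\<theta> has_real_derivative inverse (1 / D (\<theta> t))) (at t)"
      by (rule DERIV_inverse_function[where f = \<tau> and a = "t - 1" and b = "t + 1"])
        (use \<tau> D0 \<tau>\<theta> cont\<theta> in auto)
    then show ?thesis by simp
  qed
  have \<theta>T: "\<theta> (t + T) = \<theta> t + 2 * pi" for t
    using T(2)[of "\<theta> t"] \<tau>\<theta> \<theta>\<tau> by metis
  define \<gamma> where "\<gamma> = g \<circ> (\<lambda>t. c (\<theta> t))"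
  have deriv: "(\<gamma> has_vector_derivative X (\<gamma> t)) (at t)" for t
  proof -
    let ?z = "g (c (\<theta> t))"
    have "((\<lambda>t. c (\<theta> t)) has_vector_derivative D (\<theta> t) *\<^sub>R quarter_turn (c (\<theta> t))) (at t)"
      unfolding c_def by (rule has_vector_derivative_unit_vec[OF \<theta>', unfolded c_def])
    moreover have "(g has_derivative inv (blinfun_apply (f' ?z))) (at (c (\<theta> t)))"
      using lift_has_derivative[OF g \<open>open B\<close> cB] .
    ultimately have "(\<gamma> has_vector_derivative
        inv (blinfun_apply (f' ?z)) (D (\<theta> t) *\<^sub>R quarter_turn (c (\<theta> t)))) (at t)"
      unfolding \<gamma>_def by (rule vector_derivative_diff_chain_within[OF _ has_derivative_at_withinI])
    \<comment> \<open>The velocity on the circle is the image of \<open>X\<close> under the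
      derivative of \<open>f\<close>, so the derivative of \<open>g\<close> carries it back to
      \<open>X\<close>.\<close>
    moreover have "D (\<theta> t) *\<^sub>R quarter_turn (c (\<theta> t)) = f' ?z (X ?z)"
      using f'_X[OF gU] lift_onD(3)[OF g cB] by (simp add: D_def)
    ultimately show ?thesis
      using bij_f'[OF gU] by (simp add: \<gamma>_def bij_is_inj)
  qed
  have rng: "range \<gamma> = g ` sphere 0 \<rho>"
  proof -
    have "range \<theta> = UNIV" using \<theta>\<tau> by (metis surjI)
    then have "range (\<lambda>t. c (\<theta> t)) = sphere 0 \<rho>"
      using c_range by (metis image_image)
    then show ?thesis unfolding \<gamma>_def by (metis image_comp)
  qed
  have "integral_curve X (g ` B - {z. f z = 0}) UNIV \<gamma>"
    unfolding integral_curve_def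
  proof (intro ballI conjI deriv)
    fix t
    have "c (\<theta> t) \<noteq> 0" using \<open>\<rho> > 0\<close> norm_unit_vec[of "\<theta> t"]
      by (metis c_def norm_zero scaleR_eq_0_iff zero_neq_one less_irrefl)
    then show "\<gamma> t \<in> g ` B - {z. f z = 0}"
      using cB lift_onD(3)[OF g cB] by (auto simp: \<gamma>_def)
  qed
  \<comment> \<open>\<open>T\<close> is negative when the determinant is, so the positive period is
    its absolute value.\<close>
  moreover have "\<gamma> (t + \<bar>T\<bar>) = \<gamma> t" for t
  proof -
    have p: "\<gamma> (s + T) = \<gamma> s" for s
      unfolding \<gamma>_def by (simp add: \<theta>T per)
    show ?thesis
    proof (cases "T > 0")
      case True
      then show ?thesis by (simp add: p)
    next
      case False
      then have "t + \<bar>T\<bar> + T = t" by simp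
      then show ?thesis using p[of "t + \<bar>T\<bar>"] by simp
    qed
  qed
  moreover have "\<not> \<gamma> constant_on UNIV"
  proof
    assume "\<gamma> constant_on UNIV"
    then obtain y where "\<And>t. \<gamma> t = y" by (auto simp: constant_on_def)
    \<comment> \<open>A constant curve would identify the lifts of two antipodal points of the
      circle.\<close>
    then have "g (c 0) = g (c pi)"
      using rng c_range by (metis (no_types, lifting) image_eqI rangeI rangeE)
    then have "c 0 = c pi"
      using lift_onD(4)[OF g] cB by (auto dest: inj_onD)
    then have "c 0 $ 1 = c pi $ 1" by simp
    then show False using \<open>\<rho> > 0\<close> by (simp add: c_def)
  qed
  ultimately show ?thesis
    unfolding periodic_orbit_def using T(1) rng by (metis zero_less_abs_iff)
qed

end

section \<open>Discs and period annuli\<close>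

text \<open>The plane counts as the disc of infinite radius, so both alternatives of (ii) are
  treated together.\<close>

definition disc :: "(real^2) set \<Rightarrow> bool" where
  "disc B \<longleftrightarrow> B = UNIV \<or> (\<exists>r>0. B = ball 0 r)"

lemma disc_simps:
  assumes "disc B"
  shows "open B" "connected B" "0 \<in> B" "w \<in> B \<Longrightarrow> sphere 0 (norm w) \<subseteq> B"
  using assms unfolding disc_def by (auto simp: convex_connected)

text \<open>The radius is \<open>Sup S\<close> if \<open>S\<close> is bounded above; otherwise the
  balls exhaust the plane.\<close>

lemma Union_balls_disc:
  assumes "S \<noteq> {}" "\<And>r. r \<in> S \<Longrightarrow> r > 0"
  shows "disc (\<Union>r\<in>S. ball 0 r)"
proof (cases "bdd_above S")
  case True
  have "(\<Union>r\<in>S. ball 0 r) = ball 0 (Sup S)"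
    using less_cSup_iff[OF assms(1) True] by auto
  moreover have "Sup S > 0"
    using assms less_cSup_iff[OF assms(1) True] by blast
  ultimately show ?thesis unfolding disc_def by blast
next
  case False
  have "\<exists>r\<in>S. norm w < r" for w :: "real^2"
    using False unfolding bdd_above_def by (meson not_le)
  then have "(\<Union>r\<in>S. ball 0 r) = (UNIV :: (real^2) set)" by auto
  then show ?thesis unfolding disc_def by blast
qed

context plane_local_diffeo
begin

text \<open>A punctured disc is a union of circles about \<open>0\<close>, and each circle lifts to
  a periodic orbit.\<close>

lemma periodic_nbhd_lift_disc:
  assumes g: "lift_on B g" and "disc B" and "g 0 = z0"
  shows "periodic_nbhd X U z0 (g ` B)"
proof -
  note B = disc_simps[OF \<open>disc B\<close>]
  let ?F = "(\<lambda>w. g ` sphere 0 (norm w)) ` (B - {0})"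
  have zero: "f (g w) = 0 \<longleftrightarrow> w = 0" if "w \<in> B" for w
    using lift_onD(3)[OF g that] by simp
  have "periodic_orbit X U S" if "S \<in> ?F" for S
  proof -
    obtain w where w: "w \<in> B" "w \<noteq> 0" "S = g ` sphere 0 (norm w)" using \<open>S \<in> ?F\<close> by blast
    have "periodic_orbit X (g ` B - {z. f z = 0}) S"
      unfolding w(3) using w by (intro periodic_orbit_lift_sphere[OF g] B) auto
    then show ?thesis
      by (rule periodic_orbit_mono) (use lift_onD(2)[OF g] in auto)
  qed
  moreover have "g ` B - {z0} = \<Union>?F"
  proof
    show "g ` B - {z0} \<subseteq> \<Union>?F"
      using \<open>g 0 = z0\<close> by fastforce
    show "\<Union>?F \<subseteq> g ` B - {z0}"
    proof
      fix z assume "z \<in> \<Union>?F"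
      then obtain w v where w: "w \<in> B" "w \<noteq> 0" "v \<in> sphere 0 (norm w)" "z = g v" by blast
      then have "v \<in> B" "v \<noteq> 0" using B(4)[of w] by auto
      then show "z \<in> g ` B - {z0}"
        using w(4) zero[of v] zero[OF B(3)] \<open>g 0 = z0\<close> by auto
    qed
  qed
  ultimately have "filled_with_periodic_orbits X U (g ` B - {z0})"
    unfolding filled_with_periodic_orbits_def by blast
  moreover have "connected (g ` B)"
    using connected_continuous_image[OF lift_onD(1)[OF g] B(2)] .
  moreover have "z0 \<in> g ` B" "g ` B \<subseteq> U"
    using B(3) \<open>g 0 = z0\<close> lift_onD(2)[OF g] by auto
  ultimately show ?thesis
    using open_lift_image[OF g B(1)] unfolding periodic_nbhd_def by blast
qed

text \<open>The Hamiltonian is a first integral of its field.\<close>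

lemma norm_f_integral_curve:
  assumes "integral_curve X A I \<gamma>" "A \<subseteq> U" "is_interval I" "s \<in> I" "t \<in> I"
  shows "norm (f (\<gamma> t)) = norm (f (\<gamma> s))"
  using norm_rotating_curve[of I "f \<circ> \<gamma>", OF integral_curve_image_rotates[OF assms(1,2)] assms(3-5)]
  by simp

text \<open>The orbit of \<open>p\<close> in the punctured image is the lifted circle through
  \<open>p\<close>: conservation of the norm of \<open>f\<close> keeps the orbit on it, and the
  periodic curve that traverses the circle shows that all of it is reached.\<close>

lemma is_center_lift_disc:
  assumes g: "lift_on B g" and "disc B" and "g 0 = z0"
  shows "is_center X U z0"
proof -
  note B = disc_simps[OF \<open>disc B\<close>]
  define V where "V = g ` B"
  have V: "open V" "z0 \<in> V" "V \<subseteq> U"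
    using open_lift_image[OF g B(1)] B(3) \<open>g 0 = z0\<close> lift_onD(2)[OF g] by (auto simp: V_def)
  have f_z0: "f z0 = 0" using lift_onD(3)[OF g B(3)] \<open>g 0 = z0\<close> by simp
  have zero: "f z = 0 \<longleftrightarrow> z = z0" if "z \<in> V" for z
    using lift_onD(5)[OF g] that V(2) f_z0 unfolding V_def by (metis inj_onD)
  then have V0: "V - {z. f z = 0} = V - {z0}" by blast
  obtain e where e: "e > 0" "ball z0 e \<subseteq> V"
    using V open_contains_ball by blast
  have "X z \<noteq> 0" if "z \<in> U" "0 < dist z z0" "dist z z0 < e" for z
  proof -
    have "z \<in> V" using e(2) that(3) by (auto simp: dist_commute)
    then show ?thesis using zero that X_eq_0_iff by auto
  qed
  moreover have "X z0 = 0" using X_eq_0_iff V f_z0 by blast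
  ultimately have iso: "isolated_singular_point X U z0"
    unfolding isolated_singular_point_def using V e(1) by blast
  have "periodic_orbit X (V - {z0}) (orbit X (V - {z0}) p)" if p: "p \<in> V - {z0}" for p
  proof -
    obtain w where w: "w \<in> B" "p = g w" using p by (auto simp: V_def)
    have fp: "f p = w" using lift_onD(3)[OF g w(1)] w(2) by simp
    have w0: "norm w > 0" using zero p fp by auto
    let ?S = "g ` sphere 0 (norm w)"
    have per: "periodic_orbit X (V - {z0}) ?S"
      using periodic_orbit_lift_sphere[OF g B(1) B(4)[OF w(1)] w0] unfolding V_def[symmetric] V0 .
    have "orbit X (V - {z0}) p \<subseteq> ?S"
    proof
      fix q assume "q \<in> orbit X (V - {z0}) p"
      then obtain \<gamma> I t where \<gamma>: "is_interval I" "0 \<in> I" "\<gamma> 0 = p" "integral_curve X (V - {z0}) I \<gamma>" "t \<in> I" "q = \<gamma> t"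
        unfolding orbit_def by blast
      have "norm (f q) = norm w"
        using norm_f_integral_curve[OF \<gamma>(4) _ \<gamma>(1,2,5)] V(3) \<gamma>(3,6) fp by auto
      moreover have "q \<in> V" using \<gamma>(4-6) unfolding integral_curve_def by blast
      ultimately show "q \<in> ?S"
        using lift_onD(3)[OF g] by (auto simp: V_def)
    qed
    moreover have "?S \<subseteq> orbit X (V - {z0}) p"
    proof -
      obtain \<gamma> where \<gamma>: "integral_curve X (V - {z0}) UNIV \<gamma>" "?S = range \<gamma>"
        using per unfolding periodic_orbit_def by blast
      have "p \<in> ?S" using w(2) by auto
      then obtain s where s: "\<gamma> s = p" using \<gamma>(2) by auto
      \<comment> \<open>A time shift, since \<open>orbit\<close> is built from curves that are at
        \<open>p\<close> at time \<open>0\<close>.\<close>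
      define \<eta> where "\<eta> = \<gamma> \<circ> (\<lambda>t. t + s)"
      have "(\<eta> has_vector_derivative X (\<eta> t)) (at t)" for t
      proof -
        have "((\<lambda>t. t + s) has_vector_derivative 1) (at t)"
          by (auto intro!: derivative_eq_intros)
        moreover have "(\<gamma> has_vector_derivative X (\<gamma> (t + s))) (at (t + s))"
          using \<gamma>(1) unfolding integral_curve_def by blast
        ultimately have "(\<eta> has_vector_derivative 1 *\<^sub>R X (\<gamma> (t + s))) (at t)"
          unfolding \<eta>_def by (rule vector_diff_chain_at)
        then show ?thesis by (simp add: \<eta>_def)
      qed
      then have "integral_curve X (V - {z0}) UNIV \<eta>"
        using \<gamma>(1) unfolding integral_curve_def \<eta>_def by simp
      moreover have "\<eta> 0 = p" using s by (simp add: \<eta>_def)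
      ultimately have "range \<eta> \<subseteq> orbit X (V - {z0}) p"
        unfolding orbit_def
        by (intro Union_upper CollectI exI[of _ \<eta>] exI[of _ UNIV]) (simp add: is_interval_univ)
      moreover have "range \<eta> = range \<gamma>"
      proof -
        have "\<gamma> t \<in> range \<eta>" for t
          using rangeI[of \<eta> "t - s"] by (simp add: \<eta>_def)
        moreover have "\<eta> t \<in> range \<gamma>" for t by (simp add: \<eta>_def)
        ultimately show ?thesis by blast
      qed
      ultimately show ?thesis using \<gamma>(2) by simp
    qed
    ultimately have "orbit X (V - {z0}) p = ?S" by blast
    then show ?thesis using per by simp
  qed
  then show ?thesis
    unfolding is_center_def using iso V by blast
qed

section \<open>The maximal lift\<close>

text \<open>Lifts on balls about \<open>0\<close> with value \<open>z0\<close> at \<open>0\<close>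
  agree on the smaller ball, so one lift per admissible radius can be glued over the union of all
  these balls.\<close>

lemma lift_maximal:
  assumes "z0 \<in> U" "f z0 = 0"
  obtains B g where "disc B" "lift_on B g" "g 0 = z0"
    "\<And>R h. lift_on (ball 0 R) h \<Longrightarrow> h 0 = z0 \<Longrightarrow> ball 0 R \<subseteq> B"
proof -
  define S where "S = {r. r > 0 \<and> (\<exists>h. lift_on (ball 0 r) h \<and> h 0 = z0)}"
  define h where "h r = (SOME h. lift_on (ball 0 r) h \<and> h 0 = z0)" for r
  have h: "lift_on (ball 0 r) (h r)" "h r 0 = z0" if "r \<in> S" for r
  proof -
    have "\<exists>h. lift_on (ball 0 r) h \<and> h 0 = z0" using that by (simp add: S_def)
    from someI_ex[OF this] show "lift_on (ball 0 r) (h r)" "h r 0 = z0"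
      by (simp_all add: h_def)
  qed
  have pos: "r > 0" if "r \<in> S" for r using that by (simp add: S_def)
  obtain \<epsilon> k where "\<epsilon> > 0" "lift_on (ball (f z0) \<epsilon>) k" "k (f z0) = z0"
    using local_lift[OF assms(1)] .
  then have "\<epsilon> \<in> S" using assms(2) by (auto simp: S_def)
  then have "S \<noteq> {}" by blast
  have agree: "h r w = h s w" if "r \<in> S" "s \<in> S" "w \<in> ball 0 r" "w \<in> ball 0 s" for r s w
  proof -
    have "lift_on (ball 0 (min r s)) (h r)" "lift_on (ball 0 (min r s)) (h s)"
      using h that lift_on_subset by (meson min.cobounded1 min.cobounded2 subset_ball)+
    then show ?thesis
      by (rule lift_unique[where ?w0.0 = 0]) (use h that pos in \<open>auto simp: convex_connected\<close>)
  qed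
  obtain G where G: "lift_on (\<Union>r\<in>S. ball 0 r) G" "\<And>r w. r \<in> S \<Longrightarrow> w \<in> ball 0 r \<Longrightarrow> G w = h r w"
    by (rule lift_glue[of S "ball 0" h, OF open_ball h(1) agree])
      (assumption | rule that | blast)+
  show ?thesis
  proof (rule that)
    show "disc (\<Union>r\<in>S. ball 0 r)" using \<open>S \<noteq> {}\<close> pos by (rule Union_balls_disc)
    show "lift_on (\<Union>r\<in>S. ball 0 r) G" by (rule G)
    obtain r where "r \<in> S" using \<open>S \<noteq> {}\<close> by blast
    then show "G 0 = z0" using G(2)[of r 0] h pos by simp
    show "ball (0::real^2) R \<subseteq> (\<Union>r\<in>S. ball 0 r)" if "lift_on (ball 0 R) k" "k 0 = z0" for R k
    proof (cases "R > 0")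
      case True
      then have "R \<in> S" using that by (auto simp: S_def)
      then show ?thesis by blast
    next
      case False
      then have "ball (0::real^2) R = {}" by simp
      then show ?thesis by blast
    qed
  qed
qed

section \<open>Extending a lift across its bounding circle\<close>

text \<open>The image of \<open>h\<close> is an open neighborhood of \<open>z\<close>, so it meets
  the image of \<open>g\<close>. At a common point both lifts sit over the same \<open>v\<close>,
  and the intersection of the two balls is convex, so uniqueness of lifts applies.\<close>

lemma lift_agree_local:
  assumes g: "lift_on (ball 0 R) g" and h: "lift_on (ball (f z) \<epsilon>) h" "h (f z) = z" "\<epsilon> > 0"
    and z: "z \<in> closure (g ` ball 0 R)"
    and u: "u \<in> ball 0 R" "u \<in> ball (f z) \<epsilon>"
  shows "g u = h u"
proof -
  have "open (h ` ball (f z) \<epsilon>)" by (intro open_lift_image h) simp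
  moreover have "z \<in> h ` ball (f z) \<epsilon>"
    using h(2,3) by (metis centre_in_ball imageI)
  ultimately have "h ` ball (f z) \<epsilon> \<inter> g ` ball 0 R \<noteq> {}"
    using z open_Int_closure_eq_empty by blast
  then obtain v v' where v: "v \<in> ball (f z) \<epsilon>" "v' \<in> ball 0 R" "h v = g v'" by blast
  then have "v = v'"
    using lift_onD(3)[OF g v(2)] lift_onD(3)[OF h(1) v(1)] by simp
  have "lift_on (ball 0 R \<inter> ball (f z) \<epsilon>) g" "lift_on (ball 0 R \<inter> ball (f z) \<epsilon>) h"
    using lift_on_subset g h(1) by blast+
  then show ?thesis
    by (rule lift_unique[where ?w0.0 = v])
      (use u v \<open>v = v'\<close> in \<open>auto intro!: convex_connected convex_Int\<close>)
qed

text \<open>The times spent in the closure form a closed and open set. For openness, a local lift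
  \<open>h\<close> at a point of the curve agrees with \<open>g\<close> inside the disc, and nearby
  points of the curve lie over the bounding circle, hence are limits of such common values.\<close>

lemma integral_curve_in_lift_closure:
  assumes g: "lift_on (ball 0 R) g" and "R > 0"
    and \<gamma>: "integral_curve X U UNIV \<gamma>"
    and t0: "norm (f (\<gamma> t0)) = R" "\<gamma> t0 \<in> closure (g ` ball 0 R)"
  shows "\<gamma> t \<in> closure (g ` ball 0 R)"
proof -
  let ?C = "closure (g ` ball 0 R)"
  have nR: "norm (f (\<gamma> t)) = R" for t
    using norm_f_integral_curve[OF \<gamma>, of t0 t] t0(1) by (simp add: is_interval_univ)
  have \<gamma>U: "\<gamma> t \<in> U" for t using \<gamma> unfolding integral_curve_def by blast
  have cont: "continuous_on UNIV \<gamma>"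
    using \<gamma> has_vector_derivative_continuous unfolding integral_curve_def
    by (blast intro: continuous_at_imp_continuous_on)
  have "closed (\<gamma> -` ?C)"
    using continuous_closed_vimage[of ?C \<gamma>] cont by (simp add: continuous_on_eq_continuous_at)
  moreover have "open (\<gamma> -` ?C)"
  proof (subst open_subopen, intro ballI)
    fix t assume t: "t \<in> \<gamma> -` ?C"
    obtain \<epsilon> h where h: "\<epsilon> > 0" "lift_on (ball (f (\<gamma> t)) \<epsilon>) h" "h (f (\<gamma> t)) = \<gamma> t"
      using local_lift[OF \<gamma>U] .
    let ?b = "ball (f (\<gamma> t)) \<epsilon>"
    have agree: "g u = h u" if "u \<in> ball 0 R" "u \<in> ?b" for u
      using lift_agree_local[OF g h(2,3,1) _ that] t by simp
    have "open (h ` ?b)" by (intro open_lift_image h) simp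
    then have "open (\<gamma> -` (h ` ?b))" using cont open_vimage by blast
    moreover have "t \<in> \<gamma> -` (h ` ?b)"
      using h(1,3) by (metis centre_in_ball imageI vimageI)
    moreover have "\<gamma> -` (h ` ?b) \<subseteq> \<gamma> -` ?C"
    proof
      fix s assume "s \<in> \<gamma> -` (h ` ?b)"
      then obtain v where v: "v \<in> ?b" "\<gamma> s = h v" by blast
      then have "norm v = R" using nR[of s] lift_onD(3)[OF h(2) v(1)] by simp
      \<comment> \<open>\<open>v\<close> is on the bounding circle, so it can be approached from
        within the disc while staying in the domain of \<open>h\<close>.\<close>
      then have "v \<in> closure (ball 0 R)" using \<open>R > 0\<close> by simp
      then have "v \<in> closure (?b \<inter> ball 0 R)"
        using v(1) open_Int_closure_subset[of ?b "ball 0 R"] by blast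
      then obtain x where x: "\<And>n. x n \<in> ?b \<inter> ball 0 R" "x \<longlonglongrightarrow> v"
        unfolding closure_sequential by blast
      have "(\<lambda>n. h (x n)) \<longlonglongrightarrow> h v"
        using continuous_on_tendsto_compose[OF lift_onD(1)[OF h(2)] x(2) v(1)] x(1) by simp
      moreover have "h (x n) \<in> g ` ball 0 R" for n
        using agree[of "x n"] x(1)[of n] by (metis IntD1 IntD2 imageI)
      ultimately have "h v \<in> ?C"
        unfolding closure_sequential by (intro exI[of _ "\<lambda>n. h (x n)"]) blast
      then show "s \<in> \<gamma> -` ?C" using v(2) by simp
    qed
    ultimately show "\<exists>T. open T \<and> t \<in> T \<and> T \<subseteq> \<gamma> -` ?C" by blast
  qed
  ultimately have "\<gamma> -` ?C = {} \<or> \<gamma> -` ?C = UNIV"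
    by (metis clopen)
  then show ?thesis using t0(2) by blast
qed

text \<open>Each point of the bounding circle has a local lift agreeing with \<open>g\<close>. Two
  of these agree with each other because their balls, if they meet at all, also meet inside the
  disc. Gluing gives a lift on an open set containing the closed disc, and compactness leaves room
  for a larger radius.\<close>

lemma lift_extends:
  assumes g: "lift_on (ball 0 R) g" and "R > 0"
    and ext: "\<And>w. norm w = R \<Longrightarrow> \<exists>z \<in> U \<inter> closure (g ` ball 0 R). f z = w"
  obtains R' G where "R' > R" "lift_on (ball 0 R') G" "G 0 = g 0"
proof -
  have "\<exists>\<epsilon> h. \<epsilon> > 0 \<and> lift_on (ball w \<epsilon>) h \<and> (\<forall>u \<in> ball 0 R \<inter> ball w \<epsilon>. g u = h u)"
    if w: "norm w = R" for w
  proof -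
    obtain z where z: "z \<in> U" "z \<in> closure (g ` ball 0 R)" "f z = w" using ext[OF w] by blast
    obtain \<epsilon> h where h: "\<epsilon> > 0" "lift_on (ball (f z) \<epsilon>) h" "h (f z) = z"
      using local_lift[OF z(1)] .
    then have "\<forall>u \<in> ball 0 R \<inter> ball w \<epsilon>. g u = h u"
      using lift_agree_local[OF g h(2,3,1) z(2)] z(3) by blast
    then show ?thesis using h z(3) by blast
  qed
  then obtain \<epsilon> h where \<epsilon>: "\<And>w. norm w = R \<Longrightarrow> \<epsilon> w > 0"
    and h: "\<And>w. norm w = R \<Longrightarrow> lift_on (ball w (\<epsilon> w)) (h w)"
    and gh: "\<And>w u. norm w = R \<Longrightarrow> u \<in> ball 0 R \<Longrightarrow> u \<in> ball w (\<epsilon> w) \<Longrightarrow> g u = h w u"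
    by (metis IntI)
  have hh: "h w u = h w' u"
    if w: "norm w = R" "norm w' = R" and u: "u \<in> ball w (\<epsilon> w)" "u \<in> ball w' (\<epsilon> w')" for w w' u
  proof -
    let ?b = "ball w (\<epsilon> w) \<inter> ball w' (\<epsilon> w')"
    \<comment> \<open>The nearest point map of the disc is nonexpansive and fixes \<open>w\<close> and \<open>w'\<close>.\<close>
    define p where "p = closest_point (cball 0 R) u"
    have ne: "cball (0::real^2) R \<noteq> {}" using \<open>R > 0\<close> by simp
    have "dist v p \<le> dist v u" if "norm v = R" for v
      using closest_point_lipschitz[OF convex_cball closed_cball ne, of v u]
        closest_point_self[of v "cball 0 R"] that by (simp add: p_def)
    then have "p \<in> ?b" using u w by (fastforce simp: mem_ball)
    moreover have "p \<in> closure (ball 0 R)"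
      using closest_point_in_set[OF closed_cball ne] \<open>R > 0\<close> unfolding p_def by simp
    ultimately have "?b \<inter> closure (ball 0 R) \<noteq> {}" by blast
    then have "?b \<inter> ball 0 R \<noteq> {}"
      by (simp only: open_Int_closure_eq_empty[OF open_Int[OF open_ball open_ball]] simp_thms)
    then obtain v where v: "v \<in> ?b" "v \<in> ball 0 R" by blast
    have "lift_on ?b (h w)" "lift_on ?b (h w')"
      using h w lift_on_subset by blast+
    then show ?thesis
      by (rule lift_unique[where ?w0.0 = v])
        (use u v gh[OF w(1) v(2)] gh[OF w(2) v(2)] in \<open>auto intro!: convex_connected convex_Int\<close>)
  qed
  \<comment> \<open>The index \<open>0\<close>, which is not on the circle as \<open>R > 0\<close>,
    labels the given lift \<open>g\<close> on the disc; the other indices are the centers of the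
    local lifts.\<close>
  define I where "I = insert 0 (sphere (0::real^2) R)"
  define B where "B i = (if i = 0 then ball 0 R else ball i (\<epsilon> i))" for i
  define k where "k i = (if i = 0 then g else h i)" for i
  have I: "i = 0 \<or> norm i = R \<and> i \<noteq> 0" if "i \<in> I" for i
    using that \<open>R > 0\<close> by (auto simp: I_def)
  obtain G where G: "lift_on (\<Union>i\<in>I. B i) G" "\<And>i w. i \<in> I \<Longrightarrow> w \<in> B i \<Longrightarrow> G w = k i w"
  proof (rule lift_glue[of I B k])
    show "open (B i)" for i by (simp add: B_def)
    show "lift_on (B i) (k i)" if "i \<in> I" for i
      using I[OF that] g h by (auto simp: B_def k_def)
    show "k i w = k j w" if "i \<in> I" "j \<in> I" "w \<in> B i" "w \<in> B j" for i j w
      using I[OF that(1)] I[OF that(2)] that(3,4) gh[of i w] gh[of j w] hh[of i j w]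
      by (cases "i = 0"; cases "j = 0") (simp_all add: B_def k_def)
  qed blast
  have "cball 0 R \<subseteq> (\<Union>i\<in>I. B i)"
  proof
    fix w :: "real^2" assume w: "w \<in> cball 0 R"
    show "w \<in> (\<Union>i\<in>I. B i)"
    proof (cases "norm w = R")
      case True
      then have "w \<in> B w" "w \<in> I" using \<epsilon>[OF True] \<open>R > 0\<close> by (auto simp: B_def I_def)
      then show ?thesis by blast
    next
      case False
      then have "w \<in> B 0" using w by (simp add: B_def)
      then show ?thesis by (auto simp: I_def)
    qed
  qed
  moreover have "open (\<Union>i\<in>I. B i)" by (auto simp: B_def)
  ultimately obtain d where d: "d > 0" "(\<Union>x\<in>cball 0 R. ball x d) \<subseteq> (\<Union>i\<in>I. B i)"
    using compact_subset_open_imp_ball_epsilon_subset[OF compact_cball] by metis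
  have "ball 0 (R + d) \<subseteq> (\<Union>x\<in>cball (0::real^2) R. ball x d)"
  proof
    fix w :: "real^2" assume w: "w \<in> ball 0 (R + d)"
    show "w \<in> (\<Union>x\<in>cball 0 R. ball x d)"
    proof (cases "norm w \<le> R")
      case True
      then show ?thesis using d(1) by (intro UN_I[of w]) auto
    next
      case False
      then have "w \<noteq> 0" using \<open>R > 0\<close> by auto
      \<comment> \<open>The radial projection of \<open>w\<close> to the bounding circle.\<close>
      let ?x = "(R / norm w) *\<^sub>R w"
      have "w - ?x = (1 - R / norm w) *\<^sub>R w" by (simp add: algebra_simps)
      then have "dist ?x w = \<bar>1 - R / norm w\<bar> * norm w"
        by (metis dist_commute dist_norm norm_scaleR)
      also have "\<dots> = norm w - R" using False \<open>w \<noteq> 0\<close> \<open>R > 0\<close> by (simp add: abs_if field_simps)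
      finally have "dist ?x w < d" using w by simp
      moreover have "?x \<in> cball 0 R" using \<open>w \<noteq> 0\<close> \<open>R > 0\<close> by simp
      ultimately show ?thesis by (intro UN_I[of ?x]) auto
    qed
  qed
  then have "lift_on (ball 0 (R + d)) G"
    using d(2) lift_on_subset[OF G(1)] by blast
  moreover have "G 0 = g 0"
    using G(2)[of 0 0] \<open>R > 0\<close> by (simp add: I_def B_def k_def)
  ultimately show ?thesis using that[of "R + d" G] d(1) by simp
qed

text \<open>The angular velocity of the image curve is the determinant along
  \<open>\<gamma>\<close>, which is continuous, nonvanishing and periodic with
  \<open>\<gamma>\<close>.\<close>

lemma integral_curve_covers_sphere:
  assumes \<gamma>: "integral_curve X U UNIV \<gamma>" and per: "\<And>t. \<gamma> (t + T) = \<gamma> t" and "T > 0"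
    and w: "norm w = norm (f (\<gamma> t0))"
  obtains t where "f (\<gamma> t) = w"
proof -
  have \<gamma>U: "\<gamma> t \<in> U" for t using \<gamma> unfolding integral_curve_def by blast
  have cont: "continuous_on UNIV \<gamma>"
    using \<gamma> has_vector_derivative_continuous unfolding integral_curve_def
    by (blast intro: continuous_at_imp_continuous_on)
  have "sphere 0 (norm ((f \<circ> \<gamma>) t0)) \<subseteq> range (f \<circ> \<gamma>)"
  proof (rule rotating_curve_surj[where a = "\<lambda>t. jacobian_det f (\<gamma> t)" and T = T])
    show "((f \<circ> \<gamma>) has_vector_derivative jacobian_det f (\<gamma> t) *\<^sub>R quarter_turn ((f \<circ> \<gamma>) t)) (at t)" for t
      by (rule integral_curve_image_rotates[OF \<gamma>]) auto
    show "continuous_on UNIV (\<lambda>t. jacobian_det f (\<gamma> t))"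
      by (rule continuous_on_compose2[OF continuous_on_jacobian_det cont]) (use \<gamma>U in auto)
  qed (use det_nz \<gamma>U per \<open>T > 0\<close> in auto)
  then have "w \<in> range (f \<circ> \<gamma>)" using w by auto
  then show ?thesis using that by auto
qed

text \<open>As \<open>W\<close> is connected and meets the open image of \<open>g\<close> in
  \<open>z0\<close>, it suffices that the image is closed relative to \<open>W\<close>. A boundary
  point in \<open>W\<close> would lie on a periodic orbit over the whole bounding circle, and the
  lift would extend.\<close>

lemma periodic_nbhd_subset_maximal_lift:
  assumes "disc B" and g: "lift_on B g" "g 0 = z0"
    and max: "\<And>R h. lift_on (ball 0 R) h \<Longrightarrow> h 0 = z0 \<Longrightarrow> ball 0 R \<subseteq> B"
    and W: "periodic_nbhd X U z0 W"
  shows "W \<subseteq> g ` B"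
proof -
  note B = disc_simps[OF \<open>disc B\<close>]
  have WU: "W \<subseteq> U" "z0 \<in> W" "connected W" using W by (auto simp: periodic_nbhd_def)
  have "W \<inter> closure (g ` B) \<subseteq> g ` B"
  proof
    fix q assume q: "q \<in> W \<inter> closure (g ` B)"
    then have qU: "q \<in> U" and qcl: "q \<in> closure (g ` B)" using WU by blast+
    show "q \<in> g ` B"
    proof (cases "f q \<in> B")
      case True
      then show ?thesis using lift_image_closure[OF g(1) qU] q by blast
    next
      case False
      then obtain R where R: "R > 0" "B = ball 0 R"
        using \<open>disc B\<close> unfolding disc_def by blast
      note gR = g(1)[unfolded R(2)]
      have "f q \<in> closure (f ` g ` B)"
      proof -
        obtain x where x: "\<And>n. x n \<in> g ` B" "x \<longlonglongrightarrow> q"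
          using qcl unfolding closure_sequential by blast
        have "isCont f q"
          using deriv_f[OF qU] has_derivative_continuous by blast
        then have "(\<lambda>n. f (x n)) \<longlonglongrightarrow> f q"
          using x(2) isCont_tendsto_compose by blast
        then show ?thesis
          unfolding closure_sequential using x(1) by (intro exI[of _ "\<lambda>n. f (x n)"]) blast
      qed
      then have "norm (f q) \<le> R"
        using R unfolding lift_onD(6)[OF g(1)] by simp
      then have fq: "norm (f q) = R" using False R by simp
      \<comment> \<open>\<open>z0\<close> lies over \<open>0\<close>, which is in \<open>B\<close>;
        so \<open>q\<close> is on one of the periodic orbits that fill
        \<open>W - {z0}\<close>.\<close>
      have "q \<noteq> z0" using False lift_onD(3)[OF g(1) B(3)] g(2) B(3) by auto
      then obtain S where S: "periodic_orbit X U S" "q \<in> S"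
        using W q unfolding periodic_nbhd_def filled_with_periodic_orbits_def by blast
      then obtain \<gamma> T where \<gamma>: "integral_curve X U UNIV \<gamma>" "T > 0" "\<And>t. \<gamma> (t + T) = \<gamma> t" "S = range \<gamma>"
        unfolding periodic_orbit_def by blast
      obtain t0 where t0: "\<gamma> t0 = q" using S(2) \<gamma>(4) by blast
      have cl: "\<gamma> t \<in> closure (g ` ball 0 R)" for t
        by (rule integral_curve_in_lift_closure[OF gR R(1) \<gamma>(1), of t0])
          (use t0 fq q R(2) in auto)
      have "\<exists>z \<in> U \<inter> closure (g ` ball 0 R). f z = w" if w: "norm w = R" for w
      proof -
        obtain t where "f (\<gamma> t) = w"
            by (rule integral_curve_covers_sphere[OF \<gamma>(1,3,2), of w t0]) (use t0 fq w in auto)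
        moreover have "\<gamma> t \<in> U" using \<gamma>(1) unfolding integral_curve_def by blast
        ultimately show ?thesis using cl by blast
      qed
      then obtain R' G where G: "R' > R" "lift_on (ball 0 R') G" "G 0 = g 0"
        using lift_extends[OF gR R(1)] by blast
      then have "ball 0 R' \<subseteq> ball (0::real^2) R" using max[of R' G] g(2) R(2) by simp
      then show ?thesis using G(1) R(1) unfolding ball_subset_ball_iff by simp
    qed
  qed
  then have eq: "W \<inter> closure (g ` B) = W \<inter> g ` B"
    using closure_subset[of "g ` B"] by blast
  have "closedin (top_of_set W) (W \<inter> g ` B)"
    using closedin_closed_Int[of "closure (g ` B)" W] eq by simp
  moreover have "openin (top_of_set W) (W \<inter> g ` B)"
    using open_lift_image[OF g(1) B(1)] by (rule openin_open_Int)
  ultimately have "W \<inter> g ` B = {} \<or> W \<inter> g ` B = W"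
    using \<open>connected W\<close> unfolding connected_clopen by blast
  moreover have "z0 \<in> g ` B" using g(2) B(3) by blast
  ultimately show ?thesis using WU(2) by blast
qed

end

section \<open>The period annulus as the image of the maximal lift\<close>

theorem corollary4:
  fixes U :: "(real^2) set" and f :: "real^2 \<Rightarrow> real^2" and z0 :: "real^2"
  assumes "open U" and "connected U"
    and "C2_on U f"
    and "\<forall>z\<in>U. jacobian_det f z \<noteq> 0"
    and "z0 \<in> U" and "f z0 = 0"
  shows "let X = hamiltonian_field (half_sq_norm f);
             P = period_annulus X U z0;
             good = (\<lambda>V. open V \<and> connected V \<and> V \<subseteq> U \<and> z0 \<in> V \<and>
                         inj_on f V \<and> (f ` V = UNIV \<or> (\<exists>r>0. f ` V = ball 0 r)))
         in is_center X U z0 \<and> good P \<and> (\<forall>V. good V \<longrightarrow> V \<subseteq> P)"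
proof -
  obtain f' :: "real^2 \<Rightarrow> (real^2) \<Rightarrow>\<^sub>L (real^2)" where
    f': "\<And>z. z \<in> U \<Longrightarrow> (f has_derivative blinfun_apply (f' z)) (at z)" and "C1_on U f'"
    using assms(3) unfolding C2_on_def by blast
  have "continuous_on U f'"
    using \<open>C1_on U f'\<close> has_derivative_continuous unfolding C1_on_def
    by (blast intro: continuous_at_imp_continuous_on)
  then interpret plane_local_diffeo U f f'
    using assms f' by unfold_locales auto
  obtain B g where g: "disc B" "lift_on B g" "g 0 = z0"
    and max: "\<And>R h. lift_on (ball 0 R) h \<Longrightarrow> h 0 = z0 \<Longrightarrow> ball 0 R \<subseteq> B"
    using lift_maximal[OF assms(5,6)] by blast
  note B = disc_simps[OF g(1)]
  let ?P = "period_annulus X U z0"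
  have center: "is_center X U z0"
    by (rule is_center_lift_disc[OF g(2,1,3)])
  have P: "?P = g ` B"
  proof
    show "?P \<subseteq> g ` B"
      by (rule periodic_nbhd_subset_maximal_lift[OF g max periodic_nbhd_period_annulus[OF center]])
    show "g ` B \<subseteq> ?P"
      by (intro period_annulus_greatest center periodic_nbhd_lift_disc g)
  qed
  have "open ?P" "connected ?P" "?P \<subseteq> U" "z0 \<in> ?P"
    using periodic_nbhd_period_annulus[OF center] by (auto simp: periodic_nbhd_def)
  moreover have "inj_on f ?P" "f ` ?P = UNIV \<or> (\<exists>r>0. f ` ?P = ball 0 r)"
    using lift_onD(5,6)[OF g(2)] g(1) unfolding P disc_def by auto
  \<comment> \<open>The inverse of \<open>f\<close> on \<open>V\<close> is a lift over a disc with
    image \<open>V\<close>, so \<open>V\<close> is itself a periodic neighborhood of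
    \<open>z0\<close>.\<close>
  moreover have "V \<subseteq> ?P" if "open V" "V \<subseteq> U" "z0 \<in> V" "inj_on f V" "f ` V = UNIV \<or> (\<exists>r>0. f ` V = ball 0 r)" for V
  proof -
    let ?h = "inv_into V f"
    have "?h 0 = z0" using inv_into_f_f[OF that(4,3)] assms(6) by simp
    moreover have "lift_on (f ` V) ?h" by (rule lift_inv_into) fact+
    moreover have "disc (f ` V)" using that(5) by (simp add: disc_def)
    ultimately have "periodic_nbhd X U z0 (?h ` f ` V)"
      by (intro periodic_nbhd_lift_disc)
    then show ?thesis
      using period_annulus_greatest[OF center] inv_into_image_cancel[OF that(4) subset_refl] by simp
  qed
  ultimately show ?thesis
    unfolding Let_def using center by blast
qed

end
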